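(* Let $S$ be a semiring and let $M$ be an $S$-semimodule. Then $M$ is simple if and only if there exists a maximal regular right congruence $\mu$ on $S$ such that $S/\mu\simeq M$ (as $S$-semimodules) and $[0]_\mu$ is a maximal $\mu$-saturated right ideal in $S$.
   Context: A semiring $(S,+,\cdot)$ is a set with $(S,+)$ a commutative monoid with identity $0$, $(S,\cdot)$ a semigroup (no multiplicative identity is assumed), multiplication distributing over addition on both sides, and $0s=s0=0$ for all $s$. An $S$-semimodule is a right $S$-semimodule: a commutative monoid $(M,+,0_M)$ with a map $M\times S\to M$ such that $(m_1+m_2)s=m_1s+m_2s$, $m(s_1+s_2)=ms_1+ms_2$, $m(s_1s_2)=(ms_1)s_2$, $m0=0_M=0_Ms$. $M$ is called minimal if $MS\neq 0$ (i.e. $ms\ne 0_M$ for some $m\in M,s\in S$) and its only subsemimodules are $(0)$ and $M$; it is called simple if it is minimal and its only $S$-semimodule congruences are the equality relation $\Delta_M$ and $\nabla_M=M\times M$. A right congruence on $S$ is an equivalence relation $\mu$ such that $(a,b)\in\mu$ implies $(a+c,b+c),(ac,bc)\in\mu$ for all $c\in S$; $[s]_\mu$ denotes the $\mu$-class of $s$. $S/\mu$ is a right $S$-semimodule via $[a]_\mu s=[as]_\mu$. A right congruence $\mu$ is regular if there exists $e\in S$ with $(es,s)\in\mu$ for every $s\in S$. A maximal regular right congruence is a regular right congruence $\mu\neq\nabla_S=S\times S$ that is maximal under inclusion among regular right congruences different from $\nabla_S$. A right ideal $I$ of $S$ is $\mu$-saturated if for all $s\in S$, $i\in I$, $(s,i)\in\mu$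 implies $s\in I$. A maximal $\mu$-saturated right ideal is a proper $\mu$-saturated right ideal that is maximal under inclusion among proper $\mu$-saturated right ideals. *)

theory Defs
  imports "HOL-Algebra.Group"
begin

text \<open>
  The scalar semiring \<open>S\<close> is a type of class \<^class>\<open>semiring_0\<close>: addition is a commutative
  monoid, multiplication is a semigroup without a postulated identity, both distributive laws
  hold, and \<open>0\<close> is absorbing. Semimodules have explicit carriers, since the carrier of the
  quotient \<open>S/\<mu>\<close> is a set of congruence classes rather than a type.
\<close>

record ('m, 's) semimodule = "'m partial_object" +
  madd :: "'m \<Rightarrow> 'm \<Rightarrow> 'm"
  mzero :: 'm
  mact :: "'m \<Rightarrow> 's \<Rightarrow> 'm"

definition madd_monoid :: "('m, 's) semimodule \<Rightarrow> 'm monoid" where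
  "madd_monoid M = \<lparr>carrier = carrier M, monoid.mult = madd M, one = mzero M\<rparr>"

definition right_semimodule :: "('m, 's::semiring_0) semimodule \<Rightarrow> bool" where
  "right_semimodule M \<longleftrightarrow>
     comm_monoid (madd_monoid M) \<and>
     (\<forall>m\<in>carrier M. \<forall>s. mact M m s \<in> carrier M) \<and>
     (\<forall>m\<in>carrier M. \<forall>n\<in>carrier M. \<forall>s.
        mact M (madd M m n) s = madd M (mact M m s) (mact M n s)) \<and>
     (\<forall>m\<in>carrier M. \<forall>s t. mact M m (s + t) = madd M (mact M m s) (mact M m t)) \<and>
     (\<forall>m\<in>carrier M. \<forall>s t. mact M m (s * t) = mact M (mact M m s) t) \<and>
     (\<forall>m\<in>carrier M. mact M m 0 = mzero M) \<and>
     (\<forall>s. mact M (mzero M) s = mzero M)"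

definition subsemimodule :: "'m set \<Rightarrow> ('m, 's::semiring_0) semimodule \<Rightarrow> bool" where
  "subsemimodule N M \<longleftrightarrow> submonoid N (madd_monoid M) \<and> (\<forall>n\<in>N. \<forall>s. mact M n s \<in> N)"

definition minimal_semimodule :: "('m, 's::semiring_0) semimodule \<Rightarrow> bool" where
  "minimal_semimodule M \<longleftrightarrow>
     (\<exists>m\<in>carrier M. \<exists>s. mact M m s \<noteq> mzero M) \<and>
     (\<forall>N. subsemimodule N M \<longrightarrow> N = {mzero M} \<or> N = carrier M)"

definition semimodule_congruence ::
    "('m, 's::semiring_0) semimodule \<Rightarrow> ('m \<times> 'm) set \<Rightarrow> bool" where
  "semimodule_congruence M \<rho> \<longleftrightarrow>
     equiv (carrier M) \<rho> \<and>
     (\<forall>a b. (a, b) \<in> \<rho> \<longrightarrow>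
        (\<forall>c\<in>carrier M. (madd M a c, madd M b c) \<in> \<rho>) \<and>
        (\<forall>s. (mact M a s, mact M b s) \<in> \<rho>))"

definition simple_semimodule :: "('m, 's::semiring_0) semimodule \<Rightarrow> bool" where
  "simple_semimodule M \<longleftrightarrow>
     minimal_semimodule M \<and>
     (\<forall>\<rho>. semimodule_congruence M \<rho> \<longrightarrow>
        \<rho> = Id_on (carrier M) \<or> \<rho> = carrier M \<times> carrier M)"

definition semimodule_isos ::
    "('m, 's::semiring_0) semimodule \<Rightarrow> ('n, 's) semimodule \<Rightarrow> ('m \<Rightarrow> 'n) set" where
  "semimodule_isos M N =
     {f \<in> iso (madd_monoid M) (madd_monoid N).
        f (mzero M) = mzero N \<and>
        (\<forall>m\<in>carrier M. \<forall>s. f (mact M m s) = mact N (f m) s)}"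

definition semimodule_isomorphic ::
    "('m, 's::semiring_0) semimodule \<Rightarrow> ('n, 's) semimodule \<Rightarrow> bool" where
  "semimodule_isomorphic M N \<longleftrightarrow> semimodule_isos M N \<noteq> {}"

definition right_congruence :: "('s::semiring_0 \<times> 's) set \<Rightarrow> bool" where
  "right_congruence \<mu> \<longleftrightarrow>
     equiv UNIV \<mu> \<and>
     (\<forall>a b c. (a, b) \<in> \<mu> \<longrightarrow> (a + c, b + c) \<in> \<mu> \<and> (a * c, b * c) \<in> \<mu>)"

definition regular_right_congruence :: "('s::semiring_0 \<times> 's) set \<Rightarrow> bool" where
  "regular_right_congruence \<mu> \<longleftrightarrow> right_congruence \<mu> \<and> (\<exists>e. \<forall>s. (e * s, s) \<in> \<mu>)"

definition maximal_regular_right_congruence :: "('s::semiring_0 \<times> 's) set \<Rightarrow> bool" where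
  "maximal_regular_right_congruence \<mu> \<longleftrightarrow>
     regular_right_congruence \<mu> \<and> \<mu> \<noteq> UNIV \<and>
     (\<forall>\<nu>. regular_right_congruence \<nu> \<and> \<nu> \<noteq> UNIV \<and> \<mu> \<subseteq> \<nu> \<longrightarrow> \<nu> = \<mu>)"

definition quotient_semimodule ::
    "('s::semiring_0 \<times> 's) set \<Rightarrow> ('s set, 's) semimodule" where
  "quotient_semimodule \<mu> =
     \<lparr>carrier = UNIV // \<mu>,
      madd = (\<lambda>A B. \<Union>a\<in>A. \<Union>b\<in>B. \<mu> `` {a + b}),
      mzero = \<mu> `` {0},
      mact = (\<lambda>A s. \<Union>a\<in>A. \<mu> `` {a * s})\<rparr>"

definition right_ideal :: "'s::semiring_0 set \<Rightarrow> bool" where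
  "right_ideal I \<longleftrightarrow>
     0 \<in> I \<and> (\<forall>a\<in>I. \<forall>b\<in>I. a + b \<in> I) \<and> (\<forall>a\<in>I. \<forall>s. a * s \<in> I)"

definition saturated_right_ideal :: "('s::semiring_0 \<times> 's) set \<Rightarrow> 's set \<Rightarrow> bool" where
  "saturated_right_ideal \<mu> I \<longleftrightarrow>
     right_ideal I \<and> (\<forall>s. \<forall>i\<in>I. (s, i) \<in> \<mu> \<longrightarrow> s \<in> I)"

definition maximal_saturated_right_ideal ::
    "('s::semiring_0 \<times> 's) set \<Rightarrow> 's set \<Rightarrow> bool" where
  "maximal_saturated_right_ideal \<mu> I \<longleftrightarrow>
     saturated_right_ideal \<mu> I \<and> I \<noteq> UNIV \<and>
     (\<forall>J. saturated_right_ideal \<mu> J \<and> J \<noteq> UNIV \<and> I \<subseteq> J \<longrightarrow> J = I)"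

lemma quotient_semimodule_carrier: "carrier (quotient_semimodule \<mu>) = UNIV // \<mu>"
  by (simp add: quotient_semimodule_def)

lemma quotient_semimodule_zero: "mzero (quotient_semimodule \<mu>) = \<mu> `` {0}"
  by (simp add: quotient_semimodule_def)

lemma quotient_semimodule_add:
  fixes a b :: "'s::semiring_0"
  assumes "right_congruence \<mu>"
  shows "madd (quotient_semimodule \<mu>) (\<mu> `` {a}) (\<mu> `` {b}) = \<mu> `` {a + b}"
proof -
  have eq: "equiv UNIV \<mu>"
    and add: "\<And>a b c. (a, b) \<in> \<mu> \<Longrightarrow> (a + c, b + c) \<in> \<mu>"
    using assms by (auto simp: right_congruence_def)
  have "congruent2 \<mu> \<mu> (\<lambda>a b. \<mu> `` {a + b})"
  proof (rule congruent2_commuteI[OF eq])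
    show "\<mu> `` {y + z} = \<mu> `` {z + y}" for y z :: 's
      by (simp add: add.commute)
    show "\<mu> `` {w + y} = \<mu> `` {w + z}" if "(y, z) \<in> \<mu>" for w y z
      using equiv_class_eq[OF eq add[OF that, of w]] by (simp add: add.commute)
  qed
  then show ?thesis
    by (simp add: quotient_semimodule_def UN_equiv_class2[OF eq eq])
qed

lemma quotient_semimodule_act:
  fixes a s :: "'s::semiring_0"
  assumes "right_congruence \<mu>"
  shows "mact (quotient_semimodule \<mu>) (\<mu> `` {a}) s = \<mu> `` {a * s}"
proof -
  have eq: "equiv UNIV \<mu>" and mul: "\<And>a b c. (a, b) \<in> \<mu> \<Longrightarrow> (a * c, b * c) \<in> \<mu>"
    using assms by (auto simp: right_congruence_def)
  have "congruent \<mu> (\<lambda>a. \<mu> `` {a * s})"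
    by (rule congruentI) (rule equiv_class_eq[OF eq mul])
  then show ?thesis
    by (simp add: quotient_semimodule_def UN_equiv_class[OF eq])
qed

lemma right_semimodule_quotient:
  assumes "right_congruence \<mu>"
  shows "right_semimodule (quotient_semimodule \<mu>)"
  unfolding right_semimodule_def
proof (intro conjI)
  note q = quotient_semimodule_add[OF assms] quotient_semimodule_act[OF assms]
    quotient_semimodule_zero quotient_semimodule_carrier
  show "comm_monoid (madd_monoid (quotient_semimodule \<mu>))"
    by (rule comm_monoidI)
      (auto simp: madd_monoid_def q algebra_simps elim!: quotientE intro!: quotientI)
qed (auto simp: quotient_semimodule_add[OF assms] quotient_semimodule_act[OF assms]
    quotient_semimodule_zero quotient_semimodule_carrier algebra_simps
    elim!: quotientE intro!: quotientI)

end

theory Submission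
  imports Defs
begin

text \<open>
  Everything happens on a surjective homomorphism \<open>\<phi>\<close> from \<open>S\<close>, as a right semimodule over
  itself, onto \<open>M\<close>. Taking images and preimages under \<open>\<phi>\<close> matches the subsemimodules of \<open>M\<close> with
  the right ideals of \<open>S\<close> saturated for the kernel of \<open>\<phi>\<close>, and the semimodule congruences of \<open>M\<close>
  with the right congruences of \<open>S\<close> above that kernel (\<open>saturated_ideal_correspondence\<close>,
  \<open>congruence_correspondence\<close>). A right congruence above a regular one is again regular, with
  the same \<open>e\<close>. So, when the kernel \<open>\<mu>\<close> is regular, the two conditions in the definition of a
  simple semimodule translate into the maximality of \<open>[0]\<^sub>\<mu>\<close> and of \<open>\<mu>\<close>
  (\<open>simple_iff_maximal_kernel\<close>).

  It remains to find \<open>\<phi>\<close>. If \<open>M\<close> is minimal and \<open>m s \<noteq> 0\<close> for some \<open>s\<close>, then \<open>m S\<close> is a nonzero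
  subsemimodule, hence all of \<open>M\<close>, and \<open>\<phi> s = m s\<close> is surjective. Its kernel is regular because
  \<open>m \<in> m S\<close>: any \<open>e\<close> with \<open>m e = m\<close> satisfies \<open>m (e s) = m s\<close>. Conversely, an isomorphism
  \<open>S/\<mu> \<simeq> M\<close> composed with the projection of \<open>S\<close> onto \<open>S/\<mu>\<close> is such a \<open>\<phi>\<close>, with kernel \<open>\<mu>\<close>.
\<close>

text \<open>
  This transports "the only subsemimodules are these two" and "the only congruences are these two"
  along the two correspondences below.
\<close>

lemma bij_betw_only_two_iff:
  assumes "bij_betw f A B" and "a \<in> A" and "b \<in> A"
  shows "(\<forall>x\<in>A. x = a \<or> x = b) \<longleftrightarrow> (\<forall>y\<in>B. y = f a \<or> y = f b)"
proof -
  have "B = f ` A" and "inj_on f A"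
    using assms(1) by (auto simp: bij_betw_def)
  then show ?thesis
    using assms(2,3) by (simp add: inj_on_eq_iff)
qed

section \<open>Surjective homomorphisms from the semiring onto a semimodule\<close>

locale semiring_onto_semimodule =
  fixes M :: "('m, 's::semiring_0) semimodule" and \<phi> :: "'s \<Rightarrow> 'm"
  assumes map_zero: "\<phi> 0 = mzero M"
    and map_add: "\<phi> (s + t) = madd M (\<phi> s) (\<phi> t)"
    and map_mult: "\<phi> (s * t) = mact M (\<phi> s) t"
    and surj_carrier: "range \<phi> = carrier M"
begin

definition kernel :: "('s \<times> 's) set" where
  "kernel = {(s, t). \<phi> s = \<phi> t}"

lemma kernel_iff: "(s, t) \<in> kernel \<longleftrightarrow> \<phi> s = \<phi> t"
  by (simp add: kernel_def)

lemma map_in_carrier: "\<phi> s \<in> carrier M"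
  using surj_carrier by blast

lemma right_congruence_kernel: "right_congruence kernel"
  unfolding right_congruence_def
  by (auto simp: kernel_iff map_add map_mult intro!: equivI refl_onI symI transI)

lemma kernel_class: "kernel `` {s} = {t. \<phi> t = \<phi> s}"
  by (auto simp: kernel_iff)

lemma quotient_kernel_isomorphic: "semimodule_isomorphic (quotient_semimodule kernel) M"
proof -
  define f where "f A = (THE x. \<exists>s\<in>A. x = \<phi> s)" for A
  have f: "f (kernel `` {s}) = \<phi> s" for s
    unfolding f_def by (rule the_equality) (auto simp: kernel_class)
  note q = quotient_semimodule_add[OF right_congruence_kernel]
    quotient_semimodule_act[OF right_congruence_kernel]
    quotient_semimodule_zero quotient_semimodule_carrier
  have "bij_betw f (UNIV // kernel) (carrier M)"
  proof (rule bij_betw_imageI)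
    show "inj_on f (UNIV // kernel)"
      by (rule inj_onI) (auto simp: f kernel_iff elim!: quotientE)
    have "f ` (UNIV // kernel) = range \<phi>"
      by (auto simp: f elim!: quotientE) (metis UNIV_I f image_eqI quotientI)
    then show "f ` (UNIV // kernel) = carrier M"
      by (simp add: surj_carrier)
  qed
  then have "f \<in> semimodule_isos (quotient_semimodule kernel) M"
    by (auto simp: semimodule_isos_def iso_def hom_def madd_monoid_def q f map_zero map_add
        map_mult map_in_carrier elim!: quotientE)
  then show ?thesis
    unfolding semimodule_isomorphic_def by blast
qed

text \<open>
  A set is saturated for the kernel exactly when it is a union of fibres of \<open>\<phi>\<close>, that is, when it
  is the preimage of its own image.
\<close>

lemma saturated_right_ideal_iff:
  "saturated_right_ideal kernel J \<longleftrightarrow> right_ideal J \<and> \<phi> -` (\<phi> ` J) = J"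
  unfolding saturated_right_ideal_def kernel_iff by (auto simp: image_iff)

lemma saturated_right_ideal_vimage:
  assumes "subsemimodule N M"
  shows "saturated_right_ideal kernel (\<phi> -` N)"
  using assms unfolding subsemimodule_def submonoid_def
  by (auto simp: saturated_right_ideal_def right_ideal_def kernel_iff madd_monoid_def
      map_zero map_add map_mult)

lemma subsemimodule_image:
  assumes "right_ideal J"
  shows "subsemimodule (\<phi> ` J) M"
  unfolding subsemimodule_def submonoid_def
proof (intro conjI allI ballI impI)
  show "\<phi> ` J \<subseteq> carrier (madd_monoid M)"
    by (auto simp: madd_monoid_def map_in_carrier)
  show "x \<otimes>\<^bsub>madd_monoid M\<^esub> y \<in> \<phi> ` J" if "x \<in> \<phi> ` J" "y \<in> \<phi> ` J" for x y
    using that assms by (auto simp: madd_monoid_def right_ideal_def simp flip: map_add)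
  show "\<one>\<^bsub>madd_monoid M\<^esub> \<in> \<phi> ` J"
    using assms by (auto simp: madd_monoid_def right_ideal_def simp flip: map_zero)
  show "mact M x s \<in> \<phi> ` J" if "x \<in> \<phi> ` J" for x s
    using that assms by (auto simp: right_ideal_def simp flip: map_mult)
qed

lemma saturated_ideal_correspondence:
  "bij_betw (\<lambda>N. \<phi> -` N) {N. subsemimodule N M} {J. saturated_right_ideal kernel J}"
proof (rule bij_betw_byWitness[where f' = "\<lambda>J. \<phi> ` J"])
  show "\<forall>N\<in>{N. subsemimodule N M}. \<phi> ` (\<phi> -` N) = N"
    using surj_carrier
    by (auto simp: subsemimodule_def submonoid_def madd_monoid_def image_vimage_eq)
qed (auto simp: saturated_right_ideal_iff subsemimodule_image
    dest: saturated_right_ideal_vimage[unfolded saturated_right_ideal_iff])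

lemma right_congruence_vimage:
  assumes "semimodule_congruence M \<rho>"
  shows "right_congruence {(s, t). (\<phi> s, \<phi> t) \<in> \<rho>}"
    and "kernel \<subseteq> {(s, t). (\<phi> s, \<phi> t) \<in> \<rho>}"
proof -
  have eq: "equiv (carrier M) \<rho>"
    using assms by (simp add: semimodule_congruence_def)
  show "kernel \<subseteq> {(s, t). (\<phi> s, \<phi> t) \<in> \<rho>}"
    using eq by (auto simp: kernel_iff elim!: equivE intro: refl_onD[OF _ map_in_carrier])
  have "equiv UNIV {(s, t). (\<phi> s, \<phi> t) \<in> \<rho>}"
    using eq map_in_carrier
    by (auto intro!: equivI refl_onI symI transI elim!: equivE dest: refl_onD symD transD)
  then show "right_congruence {(s, t). (\<phi> s, \<phi> t) \<in> \<rho>}"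
    using assms map_in_carrier
    by (auto simp: right_congruence_def semimodule_congruence_def map_add map_mult)
qed

text \<open>
  Without \<open>kernel \<subseteq> \<nu>\<close> the image of \<open>\<nu>\<close> in \<open>M \<times> M\<close> need not be transitive; with it, membership of
  a pair in the image does not depend on the chosen preimages.
\<close>

lemma image_congruence_iff:
  assumes "right_congruence \<nu>" and "kernel \<subseteq> \<nu>"
  shows "(\<phi> s, \<phi> t) \<in> map_prod \<phi> \<phi> ` \<nu> \<longleftrightarrow> (s, t) \<in> \<nu>"
proof
  assume "(\<phi> s, \<phi> t) \<in> map_prod \<phi> \<phi> ` \<nu>"
  then obtain a b where "(a, b) \<in> \<nu>" "\<phi> s = \<phi> a" "\<phi> b = \<phi> t"
    by auto
  moreover from this have "(s, a) \<in> \<nu>" "(b, t) \<in> \<nu>"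
    using assms(2) by (auto simp: kernel_iff)
  moreover have "trans \<nu>"
    using assms(1) by (simp add: right_congruence_def equiv_def)
  ultimately show "(s, t) \<in> \<nu>"
    by (meson transD)
qed force

lemma semimodule_congruence_image:
  assumes "right_congruence \<nu>" and "kernel \<subseteq> \<nu>"
  shows "semimodule_congruence M (map_prod \<phi> \<phi> ` \<nu>)"
proof -
  note iff = image_congruence_iff[OF assms]
  have eq: "equiv UNIV \<nu>"
    and add: "\<And>a b c. (a, b) \<in> \<nu> \<Longrightarrow> (a + c, b + c) \<in> \<nu>"
    and mult: "\<And>a b c. (a, b) \<in> \<nu> \<Longrightarrow> (a * c, b * c) \<in> \<nu>"
    using assms(1) by (auto simp: right_congruence_def)
  have sub: "map_prod \<phi> \<phi> ` \<nu> \<subseteq> range \<phi> \<times> range \<phi>"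
    by auto
  have "equiv (range \<phi>) (map_prod \<phi> \<phi> ` \<nu>)"
  proof (rule equivI[OF sub])
    show "refl_on (range \<phi>) (map_prod \<phi> \<phi> ` \<nu>)"
      using eq by (intro refl_onI) (auto simp: iff elim!: equivE dest: refl_onD)
    show "sym (map_prod \<phi> \<phi> ` \<nu>)"
      using eq by (intro symI) (auto simp: iff elim!: equivE dest: symD)
    show "trans (map_prod \<phi> \<phi> ` \<nu>)"
    proof (rule transI)
      fix x y z
      assume xy: "(x, y) \<in> map_prod \<phi> \<phi> ` \<nu>" and yz: "(y, z) \<in> map_prod \<phi> \<phi> ` \<nu>"
      then obtain a b c where [simp]: "x = \<phi> a" "y = \<phi> b" "z = \<phi> c"
        by blast
      show "(x, z) \<in> map_prod \<phi> \<phi> ` \<nu>"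
        using xy yz eq by (auto simp: iff elim!: equivE dest: transD)
    qed
  qed
  moreover have "(madd M x z, madd M y z) \<in> map_prod \<phi> \<phi> ` \<nu>"
    if "(x, y) \<in> map_prod \<phi> \<phi> ` \<nu>" "z \<in> range \<phi>" for x y z
    using that by (auto simp: iff add simp flip: map_add)
  moreover have "(mact M x s, mact M y s) \<in> map_prod \<phi> \<phi> ` \<nu>"
    if "(x, y) \<in> map_prod \<phi> \<phi> ` \<nu>" for x y s
    using that by (auto simp: iff mult simp flip: map_mult)
  ultimately show ?thesis
    unfolding semimodule_congruence_def surj_carrier by blast
qed

lemma congruence_correspondence:
  "bij_betw (\<lambda>\<rho>. {(s, t). (\<phi> s, \<phi> t) \<in> \<rho>})
     {\<rho>. semimodule_congruence M \<rho>} {\<nu>. right_congruence \<nu> \<and> kernel \<subseteq> \<nu>}"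
proof (rule bij_betw_byWitness[where f' = "\<lambda>\<nu>. map_prod \<phi> \<phi> ` \<nu>"])
  show "\<forall>\<rho>\<in>{\<rho>. semimodule_congruence M \<rho>}.
      map_prod \<phi> \<phi> ` {(s, t). (\<phi> s, \<phi> t) \<in> \<rho>} = \<rho>"
  proof
    fix \<rho> assume "\<rho> \<in> {\<rho>. semimodule_congruence M \<rho>}"
    then have "\<rho> \<subseteq> range \<phi> \<times> range \<phi>"
      by (auto simp: semimodule_congruence_def surj_carrier equiv_def)
    then show "map_prod \<phi> \<phi> ` {(s, t). (\<phi> s, \<phi> t) \<in> \<rho>} = \<rho>"
      by force
  qed
qed (auto simp: image_congruence_iff right_congruence_vimage semimodule_congruence_image
    dest: right_congruence_vimage(2)[THEN subsetD])

lemma saturated_zero_class: "saturated_right_ideal kernel (kernel `` {0})"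
  unfolding saturated_right_ideal_def right_ideal_def kernel_class kernel_iff
  by (auto simp: map_add map_mult simp flip: map_zero)
    (metis add_0 map_add, metis map_mult mult_zero_left)

lemma zero_class_subset_saturated:
  assumes "saturated_right_ideal kernel J"
  shows "kernel `` {0} \<subseteq> J"
  using assms unfolding saturated_right_ideal_def right_ideal_def kernel_class kernel_iff
  by blast

lemma proper_zero_class_iff: "kernel `` {0} \<noteq> UNIV \<longleftrightarrow> kernel \<noteq> UNIV"
  by (auto simp: kernel_class kernel_def set_eq_iff) metis

lemma only_trivial_subsemimodules_iff:
  "(\<forall>N. subsemimodule N M \<longrightarrow> N = {mzero M} \<or> N = carrier M) \<longleftrightarrow>
   (\<forall>J. saturated_right_ideal kernel J \<longrightarrow> J = kernel `` {0} \<or> J = UNIV)"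
proof -
  have "subsemimodule {mzero M} M"
    using subsemimodule_image[of "{0}"] by (simp add: right_ideal_def map_zero)
  moreover have "subsemimodule (carrier M) M"
    using subsemimodule_image[of UNIV] by (simp add: right_ideal_def surj_carrier)
  moreover have "\<phi> -` {mzero M} = kernel `` {0}"
    by (auto simp: kernel_class map_zero)
  moreover have "\<phi> -` carrier M = UNIV"
    using map_in_carrier by auto
  ultimately show ?thesis
    using bij_betw_only_two_iff[OF saturated_ideal_correspondence, of "{mzero M}" "carrier M"]
    by simp
qed

lemma only_trivial_congruences_iff:
  "(\<forall>\<rho>. semimodule_congruence M \<rho> \<longrightarrow> \<rho> = Id_on (carrier M) \<or> \<rho> = carrier M \<times> carrier M) \<longleftrightarrow>
   (\<forall>\<nu>. right_congruence \<nu> \<and> kernel \<subseteq> \<nu> \<longrightarrow> \<nu> = kernel \<or> \<nu> = UNIV)"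
proof -
  have "semimodule_congruence M (Id_on (carrier M))"
    by (auto simp: semimodule_congruence_def equiv_def sym_Id_on trans_Id_on refl_on_def
        simp flip: surj_carrier map_add map_mult)
  moreover have "semimodule_congruence M (carrier M \<times> carrier M)"
    by (auto simp: semimodule_congruence_def equiv_def sym_def trans_def refl_on_def
        simp flip: surj_carrier map_add map_mult)
  moreover have "{(s, t). (\<phi> s, \<phi> t) \<in> Id_on (carrier M)} = kernel"
    using map_in_carrier by (auto simp: kernel_def)
  moreover have "{(s, t). (\<phi> s, \<phi> t) \<in> carrier M \<times> carrier M} = UNIV"
    using map_in_carrier by auto
  ultimately show ?thesis
    using bij_betw_only_two_iff[OF congruence_correspondence,
        of "Id_on (carrier M)" "carrier M \<times> carrier M"]
    by simp
qed

text \<open>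
  Nontriviality of the action is where regularity enters: if \<open>m s\<close> is always \<open>0\<close>, then
  \<open>\<phi> s = \<phi> (e s) = \<phi> e s = 0\<close> for every \<open>s\<close>.
\<close>

lemma nonzero_action_iff:
  assumes "regular_right_congruence kernel"
  shows "(\<exists>m\<in>carrier M. \<exists>s. mact M m s \<noteq> mzero M) \<longleftrightarrow> kernel \<noteq> UNIV"
proof -
  obtain e where e: "\<phi> (e * s) = \<phi> s" for s
    using assms by (auto simp: regular_right_congruence_def kernel_iff)
  have "(\<exists>m\<in>carrier M. \<exists>s. mact M m s \<noteq> mzero M) \<longleftrightarrow> (\<exists>t s. \<phi> (t * s) \<noteq> \<phi> 0)"
    by (simp add: map_mult map_zero flip: surj_carrier)
  also have "\<dots> \<longleftrightarrow> (\<exists>s. \<phi> s \<noteq> \<phi> 0)"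
    by (metis e)
  also have "\<dots> \<longleftrightarrow> kernel \<noteq> UNIV"
    by (auto simp: kernel_def set_eq_iff) metis
  finally show ?thesis .
qed

lemma simple_iff_maximal_kernel:
  assumes "regular_right_congruence kernel"
  shows "simple_semimodule M \<longleftrightarrow>
    maximal_regular_right_congruence kernel \<and> maximal_saturated_right_ideal kernel (kernel `` {0})"
proof -
  have regular: "regular_right_congruence \<nu> \<longleftrightarrow> right_congruence \<nu>" if "kernel \<subseteq> \<nu>" for \<nu>
    using assms that unfolding regular_right_congruence_def by blast
  have maximal: "maximal_regular_right_congruence kernel \<longleftrightarrow> kernel \<noteq> UNIV \<and>
      (\<forall>\<nu>. right_congruence \<nu> \<and> kernel \<subseteq> \<nu> \<longrightarrow> \<nu> = kernel \<or> \<nu> = UNIV)"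
    using assms regular unfolding maximal_regular_right_congruence_def by blast
  have saturated: "maximal_saturated_right_ideal kernel (kernel `` {0}) \<longleftrightarrow> kernel \<noteq> UNIV \<and>
      (\<forall>J. saturated_right_ideal kernel J \<longrightarrow> J = kernel `` {0} \<or> J = UNIV)"
    using saturated_zero_class zero_class_subset_saturated proper_zero_class_iff
    unfolding maximal_saturated_right_ideal_def by blast
  show ?thesis
    unfolding simple_semimodule_def minimal_semimodule_def maximal saturated
      nonzero_action_iff[OF assms] only_trivial_subsemimodules_iff only_trivial_congruences_iff
    by blast
qed

end

section \<open>Cyclic presentations of a semimodule\<close>

text \<open>
  For every \<open>m\<close> the set \<open>m S\<close> is a subsemimodule, even though it need not contain \<open>m\<close> when \<open>S\<close> has
  no identity. Choosing \<open>m\<close> with \<open>m S \<noteq> 0\<close>, minimality gives \<open>m S = M\<close>; in particular \<open>m \<in> m S\<close>,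
  which is what makes the kernel regular in the next lemma.
\<close>

lemma minimal_semimodule_cyclic:
  fixes M :: "('m, 's::semiring_0) semimodule"
  assumes "right_semimodule M" and "minimal_semimodule M"
  obtains m where "m \<in> carrier M" and "semiring_onto_semimodule M (mact M m)"
proof -
  obtain m s where m: "m \<in> carrier M" and ms: "mact M m s \<noteq> mzero M"
    using assms(2) by (auto simp: minimal_semimodule_def)
  have zero: "mact M m 0 = mzero M"
    and add: "\<And>s t. mact M m (s + t) = madd M (mact M m s) (mact M m t)"
    and mult: "\<And>s t. mact M m (s * t) = mact M (mact M m s) t"
    and carrier: "\<And>s. mact M m s \<in> carrier M"
    using assms(1) m by (auto simp: right_semimodule_def)
  have "subsemimodule (range (mact M m)) M"
    unfolding subsemimodule_def submonoid_def madd_monoid_def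
    using carrier by (auto simp: simp flip: zero add mult)
  moreover have "range (mact M m) \<noteq> {mzero M}"
    using ms by blast
  ultimately have "range (mact M m) = carrier M"
    using assms(2) by (auto simp: minimal_semimodule_def)
  then have "semiring_onto_semimodule M (mact M m)"
    by unfold_locales (auto simp: zero add mult)
  with m show ?thesis ..
qed

lemma regular_kernel_of_cyclic:
  fixes M :: "('m, 's::semiring_0) semimodule"
  assumes "m \<in> carrier M" and "semiring_onto_semimodule M (mact M m)"
  shows "regular_right_congruence (semiring_onto_semimodule.kernel (mact M m))"
proof -
  interpret semiring_onto_semimodule M "mact M m"
    by (fact assms(2))
  obtain e where "mact M m e = m"
    using assms(1) surj_carrier by (metis imageE)
  then have "(e * s, s) \<in> kernel" for s
    by (simp add: kernel_iff map_mult)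
  then show ?thesis
    using right_congruence_kernel by (auto simp: regular_right_congruence_def)
qed

lemma quotient_isomorphism_projection:
  fixes M :: "('m, 's::semiring_0) semimodule"
  assumes "right_congruence \<mu>" and "f \<in> semimodule_isos (quotient_semimodule \<mu>) M"
  shows "semiring_onto_semimodule M (\<lambda>s. f (\<mu> `` {s}))"
    and "semiring_onto_semimodule.kernel (\<lambda>s. f (\<mu> `` {s})) = \<mu>"
proof -
  note q = quotient_semimodule_add[OF assms(1)] quotient_semimodule_act[OF assms(1)]
    quotient_semimodule_zero quotient_semimodule_carrier
  have eq: "equiv UNIV \<mu>"
    using assms(1) by (simp add: right_congruence_def)
  have zero: "f (\<mu> `` {0}) = mzero M"
    and add: "\<And>s t. f (\<mu> `` {s + t}) = madd M (f (\<mu> `` {s})) (f (\<mu> `` {t}))"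
    and mult: "\<And>s t. f (\<mu> `` {s * t}) = mact M (f (\<mu> `` {s})) t"
    and bij: "bij_betw f (UNIV // \<mu>) (carrier M)"
    using assms(2)
    by (auto simp: semimodule_isos_def iso_def hom_def madd_monoid_def q quotientI
        simp flip: quotient_semimodule_add[OF assms(1)] quotient_semimodule_act[OF assms(1)])
  have "range (\<lambda>s. f (\<mu> `` {s})) = f ` (UNIV // \<mu>)"
    by (auto simp: quotient_def)
  then show onto: "semiring_onto_semimodule M (\<lambda>s. f (\<mu> `` {s}))"
    using bij by unfold_locales (auto simp: zero add mult bij_betw_def)
  have "f (\<mu> `` {s}) = f (\<mu> `` {t}) \<longleftrightarrow> (s, t) \<in> \<mu>" for s t
    using bij eq inj_on_eq_iff[of f "UNIV // \<mu>" "\<mu> `` {s}" "\<mu> `` {t}"]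
    by (simp add: bij_betw_def quotientI eq_equiv_class_iff)
  then show "semiring_onto_semimodule.kernel (\<lambda>s. f (\<mu> `` {s})) = \<mu>"
    by (auto simp: semiring_onto_semimodule.kernel_def[OF onto])
qed

theorem theorem3p6:
  fixes M :: "('m, 's::semiring_0) semimodule"
  assumes "right_semimodule M"
  shows "simple_semimodule M \<longleftrightarrow>
    (\<exists>\<mu> :: ('s \<times> 's) set.
       maximal_regular_right_congruence \<mu> \<and>
       semimodule_isomorphic (quotient_semimodule \<mu>) M \<and>
       maximal_saturated_right_ideal \<mu> (\<mu> `` {0}))"
proof
  assume simple: "simple_semimodule M"
  then have "minimal_semimodule M"
    by (simp add: simple_semimodule_def)
  with assms obtain m where m: "m \<in> carrier M" "semiring_onto_semimodule M (mact M m)"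
    by (rule minimal_semimodule_cyclic)
  interpret semiring_onto_semimodule M "mact M m"
    by (fact m(2))
  show "\<exists>\<mu> :: ('s \<times> 's) set. maximal_regular_right_congruence \<mu> \<and>
      semimodule_isomorphic (quotient_semimodule \<mu>) M \<and>
      maximal_saturated_right_ideal \<mu> (\<mu> `` {0})"
    using simple simple_iff_maximal_kernel[OF regular_kernel_of_cyclic[OF m]]
      quotient_kernel_isomorphic by blast
next
  assume "\<exists>\<mu> :: ('s \<times> 's) set. maximal_regular_right_congruence \<mu> \<and>
      semimodule_isomorphic (quotient_semimodule \<mu>) M \<and>
      maximal_saturated_right_ideal \<mu> (\<mu> `` {0})"
  then obtain \<mu> :: "('s \<times> 's) set" and f
    where maximal: "maximal_regular_right_congruence \<mu>" "maximal_saturated_right_ideal \<mu> (\<mu> `` {0})"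
      and f: "f \<in> semimodule_isos (quotient_semimodule \<mu>) M"
    by (auto simp: semimodule_isomorphic_def)
  then have regular: "regular_right_congruence \<mu>" and "right_congruence \<mu>"
    by (auto simp: maximal_regular_right_congruence_def regular_right_congruence_def)
  note projection = quotient_isomorphism_projection[OF this(2) f]
  show "simple_semimodule M"
    using semiring_onto_semimodule.simple_iff_maximal_kernel[OF projection(1)]
      maximal regular by (simp add: projection(2))
qed

end
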